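(* $(SPD(n),g_W)$ has non-negative curvature: for all $A\in SPD(n)$ and all $X,Y\in T_ASPD(n)$, $$R(X,Y,X,Y)\ge 0.$$
   Context: $SPD(n)$ is the set of real symmetric positive-definite $n\times n$ matrices, an open subset of the space $Sym(n)$ of real symmetric matrices, so $T_ASPD(n)\cong Sym(n)$. For $A\in SPD(n)$ and a real $n\times n$ matrix $X$, $\Gamma_A[X]$ denotes the unique real matrix satisfying $A\,\Gamma_A[X]+\Gamma_A[X]\,A=X$. The Wasserstein metric is the Riemannian metric $\langle X,Y\rangle_A=g_W|_A(X,Y)=\mathrm{tr}(\Gamma_A[Y]\,A\,\Gamma_A[X])=\frac12\mathrm{tr}(\Gamma_A[Y]X)$ for $X,Y\in T_ASPD(n)$, and $\nabla$ is its Levi-Civita connection. $R(X,Y,X,Y)=\langle R_{XY}X,Y\rangle_A$ with sign convention $R_{XY}Z=\nabla_{[X,Y]}Z-\nabla_X\nabla_YZ+\nabla_Y\nabla_XZ$, so that the sectional curvature of the plane spanned by $X,Y$ is $R(X,Y,X,Y)/(\langle X,X\rangle\langle Y,Y\rangle-\langle X,Y\rangle^2)$. *)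

theory Defs
  imports "HOL-Analysis.Analysis"
begin

definition Sym :: "(real^'n^'n) set" where
  "Sym = {X. transpose X = X}"

definition SPD :: "(real^'n^'n) set" where
  "SPD = {A \<in> Sym. \<forall>v. v \<noteq> 0 \<longrightarrow> v \<bullet> (A *v v) > 0}"

text \<open>For \<open>A \<in> SPD\<close> the Sylvester operator \<open>G \<mapsto> A G + G A\<close> is bijective on all square
  matrices, so the description below is proper there.\<close>

definition sylv :: "real^'n^'n \<Rightarrow> real^'n^'n \<Rightarrow> real^'n^'n" where
  "sylv A X = (THE G. A ** G + G ** A = X)"

definition wasserstein :: "real^'n^'n \<Rightarrow> real^'n^'n \<Rightarrow> real^'n^'n \<Rightarrow> real" where
  "wasserstein A X Y = trace (sylv A Y ** A ** sylv A X)"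

text \<open>\<open>SPD\<close> is an open subset of the vector space \<open>Sym\<close>, which is its tangent space at every
  point. Fields are total functions on all matrices, but only their values on \<open>SPD\<close> are ever
  constrained or used; accordingly derivatives are taken only in directions \<open>V \<in> Sym\<close>
  (where \<open>A + t V\<close> stays in \<open>SPD\<close> for small \<open>t\<close>). \<open>ddir f V A\<close> is the derivative of \<open>f\<close> at \<open>A\<close>
  in the direction \<open>V\<close>.\<close>

definition ddir :: "(real^'n^'n \<Rightarrow> 'b::real_normed_vector) \<Rightarrow> real^'n^'n \<Rightarrow> real^'n^'n \<Rightarrow> 'b" where
  "ddir f V A = vector_derivative (\<lambda>t. f (A + t *\<^sub>R V)) (at 0)"

primrec Ck :: "nat \<Rightarrow> (real^'n^'n \<Rightarrow> 'b::real_normed_vector) \<Rightarrow> bool" where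
  "Ck 0 f \<longleftrightarrow> continuous_on SPD f"
| "Ck (Suc k) f \<longleftrightarrow>
     (\<forall>A\<in>SPD. f differentiable (at A within SPD)) \<and> (\<forall>V\<in>Sym. Ck k (ddir f V))"

definition smooth_fun :: "(real^'n^'n \<Rightarrow> real) \<Rightarrow> bool" where
  "smooth_fun f \<longleftrightarrow> (\<forall>k. Ck k f)"

definition vector_field :: "(real^'n^'n \<Rightarrow> real^'n^'n) \<Rightarrow> bool" where
  "vector_field X \<longleftrightarrow> (\<forall>k. Ck k X) \<and> (\<forall>A\<in>SPD. X A \<in> Sym)"

text \<open>The Lie bracket in the linear coordinates of \<open>Sym\<close>, signed so that
  \<open>[X, Y] f = X (Y f) - Y (X f)\<close>.\<close>

definition lie_bracket ::
  "(real^'n^'n \<Rightarrow> real^'n^'n) \<Rightarrow> (real^'n^'n \<Rightarrow> real^'n^'n) \<Rightarrow> (real^'n^'n \<Rightarrow> real^'n^'n)" where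
  "lie_bracket X Y = (\<lambda>A. ddir Y (X A) A - ddir X (Y A) A)"

type_synonym 'n conn =
  "(real^'n^'n \<Rightarrow> real^'n^'n) \<Rightarrow> (real^'n^'n \<Rightarrow> real^'n^'n) \<Rightarrow> (real^'n^'n \<Rightarrow> real^'n^'n)"

definition affine_connection :: "'n::finite conn \<Rightarrow> bool" where
  "affine_connection D \<longleftrightarrow>
     (\<forall>X Y. vector_field X \<longrightarrow> vector_field Y \<longrightarrow> vector_field (D X Y)) \<and>
     (\<forall>X X' Y. vector_field X \<longrightarrow> vector_field X' \<longrightarrow> vector_field Y \<longrightarrow>
        (\<forall>A\<in>SPD. D (\<lambda>B. X B + X' B) Y A = D X Y A + D X' Y A)) \<and>
     (\<forall>f X Y. smooth_fun f \<longrightarrow> vector_field X \<longrightarrow> vector_field Y \<longrightarrow>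
        (\<forall>A\<in>SPD. D (\<lambda>B. f B *\<^sub>R X B) Y A = f A *\<^sub>R D X Y A)) \<and>
     (\<forall>X Y Y'. vector_field X \<longrightarrow> vector_field Y \<longrightarrow> vector_field Y' \<longrightarrow>
        (\<forall>A\<in>SPD. D X (\<lambda>B. Y B + Y' B) A = D X Y A + D X Y' A)) \<and>
     (\<forall>f X Y. smooth_fun f \<longrightarrow> vector_field X \<longrightarrow> vector_field Y \<longrightarrow>
        (\<forall>A\<in>SPD. D X (\<lambda>B. f B *\<^sub>R Y B) A = ddir f (X A) A *\<^sub>R Y A + f A *\<^sub>R D X Y A))"

definition torsion_free :: "'n::finite conn \<Rightarrow> bool" where
  "torsion_free D \<longleftrightarrow>
     (\<forall>X Y. vector_field X \<longrightarrow> vector_field Y \<longrightarrow>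
        (\<forall>A\<in>SPD. D X Y A - D Y X A = lie_bracket X Y A))"

definition metric_compatible ::
  "(real^'n^'n \<Rightarrow> real^'n^'n \<Rightarrow> real^'n^'n \<Rightarrow> real) \<Rightarrow> 'n::finite conn \<Rightarrow> bool" where
  "metric_compatible g D \<longleftrightarrow>
     (\<forall>X Y Z. vector_field X \<longrightarrow> vector_field Y \<longrightarrow> vector_field Z \<longrightarrow>
        (\<forall>A\<in>SPD. ddir (\<lambda>B. g B (Y B) (Z B)) (X A) A = g A (D X Y A) (Z A) + g A (Y A) (D X Z A)))"

definition levi_civita ::
  "(real^'n^'n \<Rightarrow> real^'n^'n \<Rightarrow> real^'n^'n \<Rightarrow> real) \<Rightarrow> 'n::finite conn \<Rightarrow> bool" where
  "levi_civita g D \<longleftrightarrow> affine_connection D \<and> torsion_free D \<and> metric_compatible g D"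

text \<open>The sign convention is \<open>R(X,Y)Z = D\<^sub>[\<^sub>X\<^sub>,\<^sub>Y\<^sub>] Z - D\<^sub>X D\<^sub>Y Z + D\<^sub>Y D\<^sub>X Z\<close>, for which
  \<open>g (R(X,Y)X) Y\<close> is the numerator of the sectional curvature.\<close>

definition curvature ::
  "'n::finite conn \<Rightarrow> (real^'n^'n \<Rightarrow> real^'n^'n) \<Rightarrow> (real^'n^'n \<Rightarrow> real^'n^'n) \<Rightarrow>
   (real^'n^'n \<Rightarrow> real^'n^'n) \<Rightarrow> (real^'n^'n \<Rightarrow> real^'n^'n)" where
  "curvature D X Y Z = (\<lambda>A. D (lie_bracket X Y) Z A - D X (D Y Z) A + D Y (D X Z) A)"

text \<open>The curvature is tensorial, so its value on tangent vectors at \<open>A\<close> is computed from an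
  arbitrary choice of vector fields extending them (constant fields show that one exists).\<close>

definition extension :: "real^'n^'n \<Rightarrow> real^'n^'n \<Rightarrow> (real^'n^'n \<Rightarrow> real^'n^'n)" where
  "extension A x = (SOME X. vector_field X \<and> X A = x)"

definition riemann ::
  "(real^'n^'n \<Rightarrow> real^'n^'n \<Rightarrow> real^'n^'n \<Rightarrow> real) \<Rightarrow> 'n::finite conn \<Rightarrow> real^'n^'n \<Rightarrow>
   real^'n^'n \<Rightarrow> real^'n^'n \<Rightarrow> real^'n^'n \<Rightarrow> real^'n^'n \<Rightarrow> real" where
  "riemann g D A x y z w =
     g A (curvature D (extension A x) (extension A y) (extension A z) A) w"

end

theory Submission
  imports Defs
begin

text \<open>Write \<open>a\<close>, \<open>b\<close> for the Sylvester solutions of \<open>X\<close>, \<open>Y\<close> at \<open>A\<close>. The Koszul formula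
  identifies the connection as \<open>D\<^sub>X Y = dY(X) - (a A b + b A a)\<close>. Put \<open>k = (a b - b a) / 2\<close>, which is
  skew, and let \<open>r\<close> be the symmetric solution of \<open>A r + r A = A k - k A\<close>. All remaining terms of the
  curvature cancel, and \<open>R(X,Y,X,Y) = - 3 tr(A k k) - 3 tr(A r r)\<close>. The equation for \<open>r\<close> turns this
  into \<open>3 tr((r + k) A (r - k))\<close>, and \<open>r + k\<close> is the transpose of \<open>u = r - k\<close>, so the curvature is
  \<open>3 tr(u\<^sup>T A u)\<close>, without any diagonalisation of \<open>A\<close>.\<close>

subsection \<open>Matrix algebra\<close>

lemma bounded_bilinear_matrix_mult:
  "bounded_bilinear ((**) :: real^'n^'n \<Rightarrow> real^'n^'n \<Rightarrow> real^'n^'n)"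
  unfolding bilinear_conv_bounded_bilinear[symmetric] bilinear_def
  by (auto intro!: linearI simp: matrix_matrix_mult_def vec_eq_iff algebra_simps sum.distrib sum_distrib_left)

lemma bounded_bilinear_matrix_vector_mult:
  "bounded_bilinear ((*v) :: real^'n^'n \<Rightarrow> real^'n \<Rightarrow> real^'n)"
  unfolding bilinear_conv_bounded_bilinear[symmetric] bilinear_def
  by (auto intro!: linearI simp: matrix_vector_mult_def vec_eq_iff algebra_simps sum.distrib sum_distrib_left)

interpretation mm: bounded_bilinear "(**) :: real^'n^'n \<Rightarrow> real^'n^'n \<Rightarrow> real^'n^'n"
  by (rule bounded_bilinear_matrix_mult)

lemma bounded_linear_transpose: "bounded_linear (transpose :: real^'n^'n \<Rightarrow> real^'n^'n)"
  unfolding linear_conv_bounded_linear[symmetric]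
  by (auto intro!: linearI simp: transpose_def vec_eq_iff)

lemma bounded_linear_trace: "bounded_linear (trace :: real^'n^'n \<Rightarrow> real)"
  unfolding linear_conv_bounded_linear[symmetric]
  by (auto intro!: linearI simp: trace_def sum.distrib sum_distrib_left)

lemmas matrix_ring_simps = mm.add_left mm.add_right mm.diff_left mm.diff_right mm.minus_left mm.minus_right
  mm.scaleR_left mm.scaleR_right matrix_mul_assoc

lemmas trace_simps = linear_simps[OF bounded_linear_trace]

lemmas transpose_simps = linear_simps[OF bounded_linear_transpose] matrix_transpose_mul

lemma trace_transpose [simp]: "trace (transpose M) = trace M"
  by (simp add: trace_def transpose_def)

text \<open>The diagonal entries of \<open>transpose G ** A ** G\<close> are the values of the
  quadratic form of \<open>A\<close> on the columns of \<open>G\<close>. Positive definiteness on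
  vectors thereby yields both sign and vanishing criteria for traces, with no eigenbasis.\<close>

lemma trace_congruence_eq_sum:
  "trace (transpose G ** A ** G) = (\<Sum>j\<in>UNIV. column j G \<bullet> (A *v column j G))"
  for A G :: "real^'n^'n"
  by (simp add: trace_def matrix_mul_assoc[symmetric])
    (simp add: matrix_matrix_mult_def matrix_vector_mult_def inner_vec_def transpose_def column_def)

lemma trace_congruence_nonneg:
  fixes A G :: "real^'n^'n"
  assumes "A \<in> SPD"
  shows "0 \<le> trace (transpose G ** A ** G)"
  unfolding trace_congruence_eq_sum
proof (intro sum_nonneg)
  fix j show "0 \<le> column j G \<bullet> (A *v column j G)"
    using assms by (cases "column j G = 0") (auto simp: SPD_def less_imp_le)
qed

lemma trace_congruence_eq_0:
  fixes A G :: "real^'n^'n"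
  assumes "A \<in> SPD" "trace (transpose G ** A ** G) = 0"
  shows "G = 0"
proof -
  have *: "0 \<le> column j G \<bullet> (A *v column j G)" for j
    using assms by (cases "column j G = 0") (auto simp: SPD_def less_imp_le)
  have "column j G \<bullet> (A *v column j G) = 0" for j
    using assms(2) * unfolding trace_congruence_eq_sum
    by (subst (asm) sum_nonneg_eq_0_iff) auto
  then have "column j G = 0" for j
    using assms(1) by (force simp: SPD_def)
  then show ?thesis
    by (simp add: vec_eq_iff column_def)
qed

lemma SPD_sym: "A \<in> SPD \<Longrightarrow> transpose A = A"
  by (simp add: SPD_def Sym_def)

lemma SPD_Sym: "A \<in> SPD \<Longrightarrow> A \<in> Sym"
  by (simp add: SPD_def)

lemma subspace_Sym: "subspace Sym"
  by (auto simp: subspace_def Sym_def transpose_simps)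

lemmas Sym_add = subspace_add[OF subspace_Sym]
  and Sym_diff = subspace_diff[OF subspace_Sym]
  and Sym_scaleR = subspace_scale[OF subspace_Sym]

subsection \<open>The Sylvester operator and the metric\<close>

text \<open>Multiplying the equation by \<open>transpose G\<close> and taking the trace gives the
  sum of the congruence traces of \<open>G\<close> and \<open>transpose G\<close>. Both are
  nonnegative, so both vanish.\<close>

lemma sylvester_inj:
  fixes A :: "real^'n^'n"
  assumes A: "A \<in> SPD" and G: "A ** G + G ** A = 0"
  shows "G = 0"
proof -
  have "trace (transpose G ** A ** G) + trace (transpose (transpose G) ** A ** transpose G)
      = trace (transpose G ** (A ** G + G ** A))"
    by (simp add: matrix_ring_simps trace_simps)
      (metis trace_mul_sym matrix_mul_assoc)
  also have "\<dots> = 0" using G by (simp add: trace_simps)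
  finally show ?thesis
    using trace_congruence_nonneg[OF A, of G] trace_congruence_nonneg[OF A, of "transpose G"]
      trace_congruence_eq_0[OF A, of G] by linarith
qed

lemma linear_sylvester: "linear (\<lambda>G. A ** G + G ** A)" for A :: "real^'n^'n"
  by (auto intro!: linearI simp: matrix_ring_simps algebra_simps)

text \<open>An injective linear endomorphism of a finite-dimensional space is onto; this is what
  makes the description in \<open>sylv\<close> proper.\<close>

lemma sylvester_bij:
  fixes A :: "real^'n^'n"
  assumes "A \<in> SPD"
  shows "bij (\<lambda>G. A ** G + G ** A)"
proof -
  have "inj (\<lambda>G. A ** G + G ** A)"
    using sylvester_inj[OF assms] linear_injective_0[OF linear_sylvester, of A] by blast
  then show ?thesis
    using linear_injective_imp_surjective[OF linear_sylvester] by (auto simp: bij_def)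
qed

lemma sylv_ex1:
  fixes A :: "real^'n^'n"
  assumes "A \<in> SPD"
  shows "\<exists>!G. A ** G + G ** A = X"
  using bij_pointE[OF sylvester_bij[OF assms], of X] by metis

lemma sylv_eq: "A \<in> SPD \<Longrightarrow> A ** sylv A X + sylv A X ** A = X"
  unfolding sylv_def by (rule theI'[OF sylv_ex1])

lemma sylv_unique: "A \<in> SPD \<Longrightarrow> A ** G + G ** A = X \<Longrightarrow> sylv A X = G"
  using sylv_ex1 sylv_eq by blast

lemma bounded_linear_sylv:
  assumes A: "A \<in> SPD"
  shows "bounded_linear (sylv A)"
  unfolding linear_conv_bounded_linear[symmetric]
proof (rule linearI)
  fix X Y c
  show "sylv A (X + Y) = sylv A X + sylv A Y"
    by (rule sylv_unique[OF A])
      (use sylv_eq[OF A, of X] sylv_eq[OF A, of Y] in \<open>simp add: matrix_ring_simps algebra_simps\<close>)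
  show "sylv A (c *\<^sub>R X) = c *\<^sub>R sylv A X"
    by (rule sylv_unique[OF A])
      (use sylv_eq[OF A, of X] in \<open>simp add: matrix_ring_simps flip: scaleR_add_right\<close>)
qed

lemma transpose_sylv:
  assumes A: "A \<in> SPD"
  shows "transpose (sylv A X) = sylv A (transpose X)"
proof -
  have "A ** transpose (sylv A X) + transpose (sylv A X) ** A = transpose (A ** sylv A X + sylv A X ** A)"
    by (simp only: transpose_simps SPD_sym[OF A] add.commute)
  also have "\<dots> = transpose X" by (simp only: sylv_eq[OF A])
  finally show ?thesis by (rule sylv_unique[OF A, symmetric])
qed

lemma sylv_Sym: "A \<in> SPD \<Longrightarrow> X \<in> Sym \<Longrightarrow> sylv A X \<in> Sym"
  by (simp add: Sym_def transpose_sylv)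

text \<open>Substituting \<open>A ** a + a ** A\<close> for \<open>X\<close> splits the trace in
  two. Transposition of symmetric factors and cyclicity make the two halves equal, hence the
  division by 2.\<close>

lemma wasserstein_eq_trace:
  assumes A: "A \<in> SPD" and X: "X \<in> Sym" and Y: "Y \<in> Sym"
  shows "wasserstein A X Y = trace (X ** sylv A Y) / 2"
proof -
  let ?a = "sylv A X" and ?b = "sylv A Y"
  have "trace (X ** ?b) = trace ((A ** ?a + ?a ** A) ** ?b)"
    by (simp only: sylv_eq[OF A])
  also have "\<dots> = trace (A ** ?a ** ?b) + trace (?a ** A ** ?b)"
    by (simp add: matrix_ring_simps trace_simps)
  also have "trace (A ** ?a ** ?b) = trace (transpose (A ** ?a ** ?b))" by simp
  also have "\<dots> = trace (?b ** (?a ** A))"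
    using A X Y by (simp add: matrix_transpose_mul SPD_sym transpose_sylv Sym_def)
  also have "\<dots> = trace (?a ** A ** ?b)" by (rule trace_mul_sym)
  also have "trace (?a ** A ** ?b) = trace (transpose (?a ** A ** ?b))" by simp
  also have "\<dots> = trace (?b ** A ** ?a)"
    using A X Y by (simp add: matrix_transpose_mul SPD_sym transpose_sylv Sym_def matrix_mul_assoc)
  finally show ?thesis by (simp add: wasserstein_def)
qed

lemma wasserstein_commute:
  assumes A: "A \<in> SPD" and X: "X \<in> Sym" and Y: "Y \<in> Sym"
  shows "wasserstein A X Y = wasserstein A Y X"
proof -
  have "wasserstein A X Y = trace (transpose (sylv A Y ** A ** sylv A X))"
    by (simp add: wasserstein_def)
  also have "\<dots> = wasserstein A Y X"
    using assms by (simp add: wasserstein_def matrix_transpose_mul SPD_sym transpose_sylv Sym_def matrix_mul_assoc)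
  finally show ?thesis .
qed

lemma wasserstein_definite:
  assumes A: "A \<in> SPD" and X: "X \<in> Sym" and 0: "wasserstein A X X = 0"
  shows "X = 0"
proof -
  have "trace (transpose (sylv A X) ** A ** sylv A X) = 0"
    using assms by (simp add: wasserstein_def transpose_sylv Sym_def)
  then have "sylv A X = 0" by (rule trace_congruence_eq_0[OF A])
  then show ?thesis using sylv_eq[OF A, of X] by simp
qed

lemma wasserstein_diff_left:
  "A \<in> SPD \<Longrightarrow> wasserstein A (X - Y) Z = wasserstein A X Z - wasserstein A Y Z"
  by (simp add: wasserstein_def linear_simps[OF bounded_linear_sylv] matrix_ring_simps trace_simps)

lemma wasserstein_minus_left:
  "A \<in> SPD \<Longrightarrow> wasserstein A (- X) Z = - wasserstein A X Z"
  by (simp add: wasserstein_def linear_simps[OF bounded_linear_sylv] matrix_ring_simps trace_simps)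

section \<open>Openness of \<open>SPD\<close> inside \<open>Sym\<close>\<close>

lemma SPD_open_in_Sym:
  fixes A :: "real^'n^'n"
  assumes A: "A \<in> SPD"
  obtains e where "0 < e" "\<And>H. H \<in> Sym \<Longrightarrow> norm H < e \<Longrightarrow> A + H \<in> SPD"
proof -
  interpret mv: bounded_bilinear "(*v) :: real^'n^'n \<Rightarrow> real^'n \<Rightarrow> real^'n"
    by (rule bounded_bilinear_matrix_vector_mult)
  have c: "continuous_on (sphere 0 1) (\<lambda>v. v \<bullet> (A *v v))"
    by (intro continuous_intros)
  have "sphere (0::real^'n) 1 \<noteq> {}" by simp
  from continuous_attains_inf[OF compact_sphere this c]
  obtain v0 :: "real^'n" where v0: "norm v0 = 1" "\<And>v. norm v = 1 \<Longrightarrow> v0 \<bullet> (A *v v0) \<le> v \<bullet> (A *v v)"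
    by auto
  \<comment> \<open>The minimum of the quadratic form over the unit sphere, positive by compactness.
    With \<open>K\<close> bounding the matrix-vector product, a symmetric perturbation of norm below
    \<open>m / K\<close> cannot use it up.\<close>
  define m where "m = v0 \<bullet> (A *v v0)"
  have "v0 \<noteq> 0" using v0(1) by auto
  then have m: "m > 0" using A by (simp add: m_def SPD_def)
  obtain K where K: "0 < K" "\<And>(M::real^'n^'n) v. norm (M *v v) \<le> norm M * norm v * K"
    using mv.pos_bounded by blast
  have "A + H \<in> SPD" if H: "H \<in> Sym" "norm H < m / K" for H
    unfolding SPD_def
  proof (intro CollectI conjI allI impI)
    show "A + H \<in> Sym" using Sym_add[OF SPD_Sym[OF A] H(1)] .
    fix v :: "real^'n" assume v: "v \<noteq> 0"
    define u where "u = v /\<^sub>R norm v"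
    have u: "norm u = 1" "v = norm v *\<^sub>R u" using v by (auto simp: u_def)
    have "\<bar>u \<bullet> (H *v u)\<bar> \<le> norm H * K"
      using Cauchy_Schwarz_ineq2[of u "H *v u"] K(2)[of H u] u by simp
    also have "\<dots> < m" using H(2) K(1) by (simp add: field_simps)
    finally have "0 < u \<bullet> (A *v u) + u \<bullet> (H *v u)" using v0(2)[OF u(1)] by (simp add: m_def)
    then have "0 < u \<bullet> ((A + H) *v u)" by (simp add: mv.add_left inner_add_right)
    moreover have "v \<bullet> ((A + H) *v v) = (norm v)\<^sup>2 * (u \<bullet> ((A + H) *v u))"
      by (subst (1 2) u(2)) (simp add: mv.scaleR_right power2_eq_square)
    ultimately show "0 < v \<bullet> ((A + H) *v v)" using v by simp
  qed
  then show thesis using that[of "m/K"] m K(1) by simp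
qed

lemma SPD_line_eventually:
  assumes A: "A \<in> SPD" and V: "V \<in> Sym"
  shows "\<forall>\<^sub>F t in nhds 0. A + t *\<^sub>R V \<in> SPD"
proof -
  obtain e where e: "0 < e" "\<And>H. H \<in> Sym \<Longrightarrow> norm H < e \<Longrightarrow> A + H \<in> SPD"
    using SPD_open_in_Sym[OF A] by blast
  have "((\<lambda>t. norm (t *\<^sub>R V)) \<longlongrightarrow> norm (0 *\<^sub>R V)) (nhds 0)"
    by (intro tendsto_intros filterlim_ident)
  then have "\<forall>\<^sub>F t in nhds 0. norm (t *\<^sub>R V) < e"
    using e(1) by (auto dest: order_tendstoD(2))
  then show ?thesis
    by eventually_elim (use e V in \<open>simp add: Sym_scaleR\<close>)
qed

subsection \<open>Directional derivatives on SPD\<close>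

text \<open>Relational counterpart of \<open>ddir\<close>: it also asserts that the derivative
  exists, which a value of \<open>vector_derivative\<close> alone does not.\<close>

abbreviation has_ddir ::
  "(real^'n^'n \<Rightarrow> 'b::real_normed_vector) \<Rightarrow> 'b \<Rightarrow> real^'n^'n \<Rightarrow> real^'n^'n \<Rightarrow> bool" where
  "has_ddir f d V A \<equiv> ((\<lambda>t. f (A + t *\<^sub>R V)) has_vector_derivative d) (at 0)"

lemma ddir_eq: "has_ddir f d V A \<Longrightarrow> ddir f V A = d"
  unfolding ddir_def by (rule vector_derivative_at)

lemma has_ddir_ident: "has_ddir (\<lambda>B. B) V V A"
  by (auto intro!: derivative_eq_intros)

text \<open>Near parameter 0 a line in a direction of \<open>Sym\<close> stays in
  \<open>SPD\<close>, so the arbitrary values of a field elsewhere cannot influence the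
  derivative.\<close>

lemma has_ddir_cong:
  assumes "\<And>B. B \<in> SPD \<Longrightarrow> f B = g B" "A \<in> SPD" "V \<in> Sym"
  shows "has_ddir f d V A \<longleftrightarrow> has_ddir g d V A"
  by (intro has_vector_derivative_cong_ev eventually_mono[OF SPD_line_eventually[OF assms(2,3)]])
    (use assms in auto)

lemma ddir_cong:
  assumes "\<And>B. B \<in> SPD \<Longrightarrow> f B = g B" "A \<in> SPD" "V \<in> Sym"
  shows "ddir f V A = ddir g V A"
proof -
  have "has_ddir f d V A \<longleftrightarrow> has_ddir g d V A" for d
    using assms by (rule has_ddir_cong)
  then show ?thesis by (simp add: ddir_def vector_derivative_def)
qed

lemma differentiable_imp_has_ddir:
  fixes f :: "real^'n^'n \<Rightarrow> 'b::real_normed_vector"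
  assumes f: "(f has_derivative f') (at A within SPD)" and A: "A \<in> SPD" and V: "V \<in> Sym"
  shows "has_ddir f (f' V) V A"
proof -
  define S where "S = {t. A + t *\<^sub>R V \<in> SPD}"
  \<comment> \<open>The derivative of \<open>f\<close> is known only within \<open>SPD\<close>.
    Since the admissible parameters form a neighbourhood of 0, composing with the line still yields
    a two-sided derivative.\<close>
  have "0 \<in> interior S"
    using SPD_line_eventually[OF A V] by (auto simp: S_def mem_interior eventually_nhds_metric subset_eq dist_commute)
  then have S: "at 0 within S = at 0" by (rule at_within_interior)
  have line: "((\<lambda>t. A + t *\<^sub>R V) has_derivative (\<lambda>t. t *\<^sub>R V)) (at 0 within S)"
    by (auto intro!: derivative_eq_intros)
  have "(f has_derivative f') (at (A + 0 *\<^sub>R V) within (\<lambda>t. A + t *\<^sub>R V) ` S)"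
    using f by (rule_tac has_derivative_subset[where s = SPD]) (auto simp: S_def)
  from has_derivative_in_compose[OF line this]
  show ?thesis
    using linear_scale[OF has_derivative_linear[OF f]]
    by (simp add: has_vector_derivative_def S)
qed

lemma Ck_Suc_has_ddir:
  assumes "Ck (Suc k) f" "A \<in> SPD" "V \<in> Sym"
  shows "has_ddir f (ddir f V A) V A"
proof -
  obtain f' where "(f has_derivative f') (at A within SPD)"
    using assms by (auto simp: differentiable_def)
  from differentiable_imp_has_ddir[OF this assms(2,3)] show ?thesis
    using ddir_eq by metis
qed

text \<open>The Frechet derivative within \<open>SPD\<close> supplies the linear map. It lives on
  all matrices, but is tied to \<open>ddir\<close> only on the tangent space
  \<open>Sym\<close>.\<close>

lemma Ck_Suc_ddir_linear:
  assumes "Ck (Suc k) f" "A \<in> SPD"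
  obtains f' where "linear f'" "\<And>V. V \<in> Sym \<Longrightarrow> ddir f V A = f' V"
proof -
  obtain f' where f': "(f has_derivative f') (at A within SPD)"
    using assms by (auto simp: differentiable_def)
  show thesis
    using that[OF has_derivative_linear[OF f']] ddir_eq[OF differentiable_imp_has_ddir[OF f' assms(2)]]
    by blast
qed

section \<open>Closure properties of the classes \<open>Ck\<close>\<close>

lemma Ck_cong:
  assumes "\<And>B. B \<in> SPD \<Longrightarrow> f B = g B"
  shows "Ck k f \<longleftrightarrow> Ck k g"
  using assms
proof (induction k arbitrary: f g)
  case 0
  then show ?case by (auto intro: continuous_on_eq)
next
  case (Suc k)
  have "f differentiable (at A within SPD) \<longleftrightarrow> g differentiable (at A within SPD)" if "A \<in> SPD" for A
    using has_derivative_transform[OF that] Suc.prems unfolding differentiable_def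
    by metis
  moreover have "Ck k (ddir f V) \<longleftrightarrow> Ck k (ddir g V)" if "V \<in> Sym" for V
    by (rule Suc.IH) (rule ddir_cong[OF Suc.prems _ that])
  ultimately show ?case by simp
qed

lemma Ck_const: "Ck k (\<lambda>_::real^'n^'n. c)"
proof (induction k arbitrary: c)
  case (Suc k)
  have "ddir (\<lambda>_. c) V = (\<lambda>_. 0)" for V :: "real^'n^'n"
    by (intro ext ddir_eq) simp
  with Suc show ?case by simp
qed simp

lemma Ck_diff:
  assumes "Ck k f" "Ck k g"
  shows "Ck k (\<lambda>B. f B - g B)"
  using assms
proof (induction k arbitrary: f g)
  case 0
  then show ?case by (auto intro: continuous_on_diff)
next
  case (Suc k)
  have "ddir (\<lambda>B. f B - g B) V A = ddir f V A - ddir g V A" if "V \<in> Sym" "A \<in> SPD" for V A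
    using that Suc.prems by (intro ddir_eq has_vector_derivative_diff Ck_Suc_has_ddir)
  then have "Ck k (ddir (\<lambda>B. f B - g B) V) \<longleftrightarrow> Ck k (\<lambda>A. ddir f V A - ddir g V A)" if "V \<in> Sym" for V
    using that by (intro Ck_cong)
  with Suc show ?case by (auto intro: differentiable_diff)
qed

section \<open>Symmetry of second directional derivatives\<close>

lemma Ck_Suc_line_derivative:
  assumes f: "Ck (Suc k) f" and A: "A + s *\<^sub>R V \<in> SPD" and V: "V \<in> Sym"
  shows "((\<lambda>t. f (A + t *\<^sub>R V)) has_vector_derivative ddir f V (A + s *\<^sub>R V)) (at s)"
proof -
  have "((\<lambda>t. t - s) has_vector_derivative 1) (at s)"
    by (auto intro!: derivative_eq_intros)
  from vector_diff_chain_at[OF this, of "\<lambda>t. f (A + s *\<^sub>R V + t *\<^sub>R V)"]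
  show ?thesis
    using Ck_Suc_has_ddir[OF f A V] by (simp add: o_def algebra_simps)
qed

text \<open>The second difference over a parallelogram is evaluated by two mean value theorems, one
  per side, each contributing a factor \<open>h\<close>. Pairing with \<open>w\<close> is essential:
  the mean value theorem in equality form holds for real functions only.\<close>

lemma second_difference_mvt:
  fixes f :: "real^'n^'n \<Rightarrow> 'b::real_inner"
  assumes f: "Ck 2 f" and U: "U \<in> Sym" and V: "V \<in> Sym" and h: "0 < h"
    and SPD: "\<And>s t. 0 \<le> s \<Longrightarrow> s \<le> h \<Longrightarrow> 0 \<le> t \<Longrightarrow> t \<le> h \<Longrightarrow> A + s *\<^sub>R U + t *\<^sub>R V \<in> SPD"
  obtains s t where "0 < s" "s < h" "0 < t" "t < h"
    "(f (A + h *\<^sub>R U + h *\<^sub>R V) - f (A + h *\<^sub>R U) - f (A + h *\<^sub>R V) + f A) \<bullet> w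
       = h\<^sup>2 * (ddir (ddir f U) V (A + s *\<^sub>R U + t *\<^sub>R V) \<bullet> w)"
proof -
  have f1: "Ck (Suc 1) f" and f2: "Ck (Suc 0) (ddir f U)"
    using f U by (simp_all add: numeral_2_eq_2)
  \<comment> \<open>The increment across the \<open>V\<close> side as a function of the position
    along \<open>U\<close>; its total change over \<open>[0, h]\<close> is the second
    difference.\<close>
  define \<phi> where "\<phi> s = (f (A + h *\<^sub>R V + s *\<^sub>R U) - f (A + s *\<^sub>R U)) \<bullet> w" for s
  define \<phi>' where "\<phi>' s = (ddir f U (A + h *\<^sub>R V + s *\<^sub>R U) - ddir f U (A + s *\<^sub>R U)) \<bullet> w" for s
  have "DERIV \<phi> s :> \<phi>' s" if "0 \<le> s" "s \<le> h" for s
    unfolding has_real_derivative_iff_has_vector_derivative \<phi>_def \<phi>'_def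
    using SPD[of s h] SPD[of s 0] that h
    by (intro bounded_linear.has_vector_derivative[OF bounded_linear_inner_left]
        has_vector_derivative_diff Ck_Suc_line_derivative[OF f1 _ U])
      (simp_all add: algebra_simps)
  with MVT2[OF h] obtain s where s: "0 < s" "s < h" "\<phi> h - \<phi> 0 = (h - 0) * \<phi>' s" by blast
  define \<psi> where "\<psi> t = ddir f U (A + s *\<^sub>R U + t *\<^sub>R V) \<bullet> w" for t
  define \<psi>' where "\<psi>' t = ddir (ddir f U) V (A + s *\<^sub>R U + t *\<^sub>R V) \<bullet> w" for t
  have "DERIV \<psi> t :> \<psi>' t" if "0 \<le> t" "t \<le> h" for t
    unfolding has_real_derivative_iff_has_vector_derivative \<psi>_def \<psi>'_def
    using SPD[of s t] that s
    by (intro bounded_linear.has_vector_derivative[OF bounded_linear_inner_left]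
        Ck_Suc_line_derivative[OF f2 _ V]) simp_all
  with MVT2[OF h] obtain t where t: "0 < t" "t < h" "\<psi> h - \<psi> 0 = (h - 0) * \<psi>' t" by blast
  have "\<phi>' s = \<psi> h - \<psi> 0"
    by (simp add: \<phi>'_def \<psi>_def algebra_simps)
  then have "\<phi> h - \<phi> 0 = h\<^sup>2 * \<psi>' t"
    using s(3) t(3) by (simp add: power2_eq_square)
  moreover have "\<phi> h - \<phi> 0
      = (f (A + h *\<^sub>R U + h *\<^sub>R V) - f (A + h *\<^sub>R U) - f (A + h *\<^sub>R V) + f A) \<bullet> w"
    by (simp add: \<phi>_def inner_diff_left inner_add_left add_ac)
  ultimately show thesis using that s(1,2) t(1,2) by (metis \<psi>'_def)
qed

text \<open>The second difference is unchanged when \<open>U\<close> and \<open>V\<close> are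
  exchanged. Evaluating it in both orders, dividing by the square of \<open>h\<close> and letting
  \<open>h\<close> tend to 0 gives equality by continuity of the second derivatives.\<close>

lemma ddir_ddir_commute:
  fixes f :: "real^'n^'n \<Rightarrow> 'b::real_inner"
  assumes f: "Ck 2 f" and A: "A \<in> SPD" and U: "U \<in> Sym" and V: "V \<in> Sym"
  shows "ddir (ddir f U) V A = ddir (ddir f V) U A"
proof (rule vector_eq_rdot[THEN iffD1], rule allI)
  fix w
  obtain e where e: "0 < e" "\<And>H. H \<in> Sym \<Longrightarrow> norm H < e \<Longrightarrow> A + H \<in> SPD"
    using SPD_open_in_Sym[OF A] by blast
  \<comment> \<open>The summand 1 keeps \<open>K\<close> positive even for zero directions and makes
    the norm estimate strict, so parallelograms of side at most \<open>e / K\<close> remain in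
    \<open>SPD\<close>.\<close>
  define K where "K = norm U + norm V + 1"
  have K: "K > 0" by (simp add: K_def add_nonneg_pos)
  define h where "h n = e / K / real (Suc n)" for n
  have h: "0 < h n" "h n \<le> e / K" for n
    using e(1) K divide_left_mono[of 1 "real (Suc n)" "e / K"] by (simp_all add: h_def del: of_nat_Suc)
  have h0: "h \<longlonglongrightarrow> 0"
    unfolding h_def by real_asymp
  have SPD: "A + s *\<^sub>R U + t *\<^sub>R V \<in> SPD" if "0 \<le> s" "s \<le> h n" "0 \<le> t" "t \<le> h n" for s t n
  proof -
    have "norm (s *\<^sub>R U + t *\<^sub>R V) \<le> s * norm U + t * norm V"
      using norm_triangle_ineq[of "s *\<^sub>R U" "t *\<^sub>R V"] that by simp
    also have "\<dots> \<le> h n * norm U + h n * norm V"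
      using that by (intro add_mono mult_right_mono) auto
    also have "\<dots> < h n * K" using h(1)[of n] by (simp add: K_def algebra_simps)
    also have "\<dots> \<le> e" using h(2)[of n] K by (simp add: field_simps)
    finally have "A + (s *\<^sub>R U + t *\<^sub>R V) \<in> SPD"
      using U V by (intro e(2) Sym_add Sym_scaleR)
    then show ?thesis by (simp add: add.assoc)
  qed
  have SPD': "A + t *\<^sub>R V + s *\<^sub>R U \<in> SPD" if "0 \<le> t" "t \<le> h n" "0 \<le> s" "s \<le> h n" for s t n
    using SPD[OF that(3,4,1,2)] by (simp add: add_ac)
  have "\<exists>s t s' t'. 0 < s \<and> s < h n \<and> 0 < t \<and> t < h n \<and> 0 < s' \<and> s' < h n \<and> 0 < t' \<and> t' < h n \<and>
      ddir (ddir f U) V (A + s *\<^sub>R U + t *\<^sub>R V) \<bullet> w = ddir (ddir f V) U (A + s' *\<^sub>R V + t' *\<^sub>R U) \<bullet> w" for n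
  proof -
    let ?\<Delta> = "(f (A + h n *\<^sub>R U + h n *\<^sub>R V) - f (A + h n *\<^sub>R U) - f (A + h n *\<^sub>R V) + f A) \<bullet> w"
    obtain s t where st: "0 < s" "s < h n" "0 < t" "t < h n"
      "?\<Delta> = (h n)\<^sup>2 * (ddir (ddir f U) V (A + s *\<^sub>R U + t *\<^sub>R V) \<bullet> w)"
      using second_difference_mvt[OF f U V h(1)[of n], of A w] SPD[where n = n] by blast
    obtain s' t' where st': "0 < s'" "s' < h n" "0 < t'" "t' < h n"
      "(f (A + h n *\<^sub>R V + h n *\<^sub>R U) - f (A + h n *\<^sub>R V) - f (A + h n *\<^sub>R U) + f A) \<bullet> w
       = (h n)\<^sup>2 * (ddir (ddir f V) U (A + s' *\<^sub>R V + t' *\<^sub>R U) \<bullet> w)"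
      using second_difference_mvt[OF f V U h(1)[of n], of A w] SPD'[where n = n] by blast
    have "(f (A + h n *\<^sub>R V + h n *\<^sub>R U) - f (A + h n *\<^sub>R V) - f (A + h n *\<^sub>R U) + f A) \<bullet> w = ?\<Delta>"
      by (simp add: inner_diff_left inner_add_left add_ac)
    with st(5) st'(5) h(1)[of n]
    have "ddir (ddir f U) V (A + s *\<^sub>R U + t *\<^sub>R V) \<bullet> w = ddir (ddir f V) U (A + s' *\<^sub>R V + t' *\<^sub>R U) \<bullet> w"
      by simp
    with st st' show ?thesis by blast
  qed
  then obtain s t s' t' where st: "\<And>n. 0 < s n" "\<And>n. s n < h n" "\<And>n. 0 < t n" "\<And>n. t n < h n"
      "\<And>n. 0 < s' n" "\<And>n. s' n < h n" "\<And>n. 0 < t' n" "\<And>n. t' n < h n"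
      "\<And>n. ddir (ddir f U) V (A + s n *\<^sub>R U + t n *\<^sub>R V) \<bullet> w
         = ddir (ddir f V) U (A + s' n *\<^sub>R V + t' n *\<^sub>R U) \<bullet> w"
    by metis
  have lim: "(\<lambda>n. ddir (ddir f P) Q (A + p n *\<^sub>R P + q n *\<^sub>R Q) \<bullet> w) \<longlonglongrightarrow> ddir (ddir f P) Q A \<bullet> w"
    if PQ: "P \<in> Sym" "Q \<in> Sym" and pq: "\<And>n. 0 < p n" "\<And>n. p n < h n" "\<And>n. 0 < q n" "\<And>n. q n < h n"
      and SPD: "\<And>n. A + p n *\<^sub>R P + q n *\<^sub>R Q \<in> SPD" for P Q p q
  proof -
    have "p \<longlonglongrightarrow> 0" "q \<longlonglongrightarrow> 0"
      using pq by (auto intro!: tendsto_sandwich[OF _ _ tendsto_const h0] always_eventually less_imp_le)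
    then have "(\<lambda>n. A + p n *\<^sub>R P + q n *\<^sub>R Q) \<longlonglongrightarrow> A + 0 *\<^sub>R P + 0 *\<^sub>R Q"
      by (intro tendsto_intros)
    then have lim: "(\<lambda>n. A + p n *\<^sub>R P + q n *\<^sub>R Q) \<longlonglongrightarrow> A" by simp
    have "continuous_on SPD (ddir (ddir f P) Q)"
      using f PQ by (simp add: numeral_2_eq_2)
    from continuous_on_tendsto_compose[OF this lim A] SPD
    show ?thesis by (intro tendsto_inner tendsto_const) auto
  qed
  have "(\<lambda>n. ddir (ddir f U) V (A + s n *\<^sub>R U + t n *\<^sub>R V) \<bullet> w) \<longlonglongrightarrow> ddir (ddir f U) V A \<bullet> w"
    using st by (intro lim U V SPD less_imp_le) auto
  moreover have "(\<lambda>n. ddir (ddir f V) U (A + s' n *\<^sub>R V + t' n *\<^sub>R U) \<bullet> w) \<longlonglongrightarrow> ddir (ddir f V) U A \<bullet> w"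
    using st by (intro lim U V SPD' less_imp_le) auto
  ultimately show "ddir (ddir f U) V A \<bullet> w = ddir (ddir f V) U A \<bullet> w"
    unfolding st(9) by (rule LIMSEQ_unique)
qed

section \<open>Vector fields and their directional derivatives\<close>

lemma Ck_all_ddir: "\<forall>k. Ck k f \<Longrightarrow> V \<in> Sym \<Longrightarrow> \<forall>k. Ck k (ddir f V)"
  using Ck.simps(2) by blast

text \<open>Transposition leaves the curve of values unchanged near 0, so by uniqueness of
  derivatives it fixes the derivative too.\<close>

lemma has_ddir_Sym:
  assumes d: "has_ddir W d V A" and W: "\<And>B. B \<in> SPD \<Longrightarrow> W B \<in> Sym" and A: "A \<in> SPD" and V: "V \<in> Sym"
  shows "d \<in> Sym"
proof -
  have "has_ddir (\<lambda>B. transpose (W B)) (transpose d) V A"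
    using d by (rule bounded_linear.has_vector_derivative[OF bounded_linear_transpose])
  moreover have "has_ddir (\<lambda>B. transpose (W B)) d V A"
    using d by (subst has_ddir_cong[where g = W, OF _ A V]) (use W in \<open>auto simp: Sym_def\<close>)
  ultimately have "transpose d = d"
    by (rule vector_derivative_unique_at)
  then show ?thesis by (simp add: Sym_def)
qed

lemma vector_field_const: "Z \<in> Sym \<Longrightarrow> vector_field (\<lambda>_. Z)"
  by (simp add: vector_field_def Ck_const)

lemma vector_field_has_ddir:
  "vector_field W \<Longrightarrow> A \<in> SPD \<Longrightarrow> V \<in> Sym \<Longrightarrow> has_ddir W (ddir W V A) V A"
  unfolding vector_field_def using Ck_Suc_has_ddir by blast

lemma vector_field_ddir_Sym:
  "vector_field W \<Longrightarrow> A \<in> SPD \<Longrightarrow> V \<in> Sym \<Longrightarrow> ddir W V A \<in> Sym"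
  by (rule has_ddir_Sym[OF vector_field_has_ddir]) (auto simp: vector_field_def)

lemma vector_field_Sym: "vector_field W \<Longrightarrow> A \<in> SPD \<Longrightarrow> W A \<in> Sym"
  by (simp add: vector_field_def)

lemma vector_field_ddir: "vector_field W \<Longrightarrow> V \<in> Sym \<Longrightarrow> vector_field (ddir W V)"
  using vector_field_ddir_Sym by (auto simp: vector_field_def Ck_all_ddir)

lemma ddir_along_linear:
  assumes "vector_field W" "A \<in> SPD"
  obtains f' where "linear f'" "\<And>V. V \<in> Sym \<Longrightarrow> ddir W V A = f' V"
  using assms Ck_Suc_ddir_linear unfolding vector_field_def by blast

lemma ddir_along_diff:
  assumes "vector_field W" "A \<in> SPD" "U \<in> Sym" "V \<in> Sym"
  shows "ddir W (U - V) A = ddir W U A - ddir W V A"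
  using ddir_along_linear[OF assms(1,2)] assms(3,4) Sym_diff linear_diff by metis

text \<open>Only directional derivatives in \<open>Sym\<close> are controlled, so fields are expanded over the
  symmetrised standard basis, a spanning family of \<open>Sym\<close> that need not be independent.\<close>

lemma symmetrized_expansion:
  fixes H :: "real^'n^'n"
  assumes "H \<in> Sym"
  shows "H = (\<Sum>b\<in>Basis. (H \<bullet> b) *\<^sub>R ((1/2) *\<^sub>R (b + transpose b)))"
proof -
  have e: "H = (\<Sum>b\<in>Basis. (H \<bullet> b) *\<^sub>R b)" by (simp add: euclidean_representation)
  have "H = (1/2) *\<^sub>R (H + transpose H)" using assms by (simp add: Sym_def flip: scaleR_2)
  also have "\<dots> = (1/2) *\<^sub>R ((\<Sum>b\<in>Basis. (H \<bullet> b) *\<^sub>R b) + transpose (\<Sum>b\<in>Basis. (H \<bullet> b) *\<^sub>R b))"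
    using e by simp
  also have "transpose (\<Sum>b\<in>Basis. (H \<bullet> b) *\<^sub>R b) = (\<Sum>b\<in>Basis. (H \<bullet> b) *\<^sub>R transpose b)"
    by (simp add: linear_sum[OF bounded_linear.linear[OF bounded_linear_transpose]] transpose_simps)
  finally show ?thesis
    by (simp add: scaleR_sum_right scaleR_add_right sum.distrib mult.commute)
qed

text \<open>A product rule for a derivative whose direction varies with the point. Expanding
  \<open>Y B\<close> turns the varying direction into real coefficients times derivatives in fixed
  directions, which can be differentiated termwise.\<close>

lemma has_ddir_ddir_along_field:
  fixes Y Z :: "real^'n^'n \<Rightarrow> real^'n^'n"
  assumes Y: "vector_field Y" and Z: "vector_field Z" and A: "A \<in> SPD" and V: "V \<in> Sym"
  shows "has_ddir (\<lambda>B. ddir Z (Y B) B) (ddir Z (ddir Y V A) A + ddir (ddir Z (Y A)) V A) V A"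
proof -
  define \<sigma> :: "real^'n^'n \<Rightarrow> real^'n^'n" where "\<sigma> b = (1/2) *\<^sub>R (b + transpose b)" for b
  have \<sigma>: "\<sigma> b \<in> Sym" for b
    by (simp add: \<sigma>_def Sym_def transpose_simps add.commute)
  have expand: "ddir W H B = (\<Sum>b\<in>Basis. (H \<bullet> b) *\<^sub>R ddir W (\<sigma> b) B)"
    if W: "vector_field W" and B: "B \<in> SPD" and H: "H \<in> Sym" for W B H
  proof -
    obtain f' where f': "linear f'" "\<And>V. V \<in> Sym \<Longrightarrow> ddir W V B = f' V"
      using ddir_along_linear[OF W B] by blast
    have "ddir W H B = f' (\<Sum>b\<in>Basis. (H \<bullet> b) *\<^sub>R \<sigma> b)"
      using symmetrized_expansion[OF H] f'(2)[OF H] by (simp add: \<sigma>_def)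
    then show ?thesis using f' \<sigma> by (simp add: linear_sum linear_scale)
  qed
  have Z2: "Ck 2 Z" using Z by (simp add: vector_field_def)
  have YA: "Y A \<in> Sym" by (rule vector_field_Sym[OF Y A])
  have "has_ddir (\<lambda>B. \<Sum>b\<in>Basis. (Y B \<bullet> b) *\<^sub>R ddir Z (\<sigma> b) B)
      (\<Sum>b\<in>Basis. (Y (A + 0 *\<^sub>R V) \<bullet> b) *\<^sub>R ddir (ddir Z (\<sigma> b)) V A
          + (ddir Y V A \<bullet> b) *\<^sub>R ddir Z (\<sigma> b) (A + 0 *\<^sub>R V)) V A"
    by (intro has_vector_derivative_sum bounded_bilinear.has_vector_derivative[OF bounded_bilinear_scaleR]
        bounded_linear.has_vector_derivative[OF bounded_linear_inner_left]
        vector_field_has_ddir vector_field_ddir Y Z A V \<sigma>)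
  also have "(\<Sum>b\<in>Basis. (Y (A + 0 *\<^sub>R V) \<bullet> b) *\<^sub>R ddir (ddir Z (\<sigma> b)) V A
          + (ddir Y V A \<bullet> b) *\<^sub>R ddir Z (\<sigma> b) (A + 0 *\<^sub>R V))
      = (\<Sum>b\<in>Basis. (Y A \<bullet> b) *\<^sub>R ddir (ddir Z V) (\<sigma> b) A) + ddir Z (ddir Y V A) A"
    \<comment> \<open>Exchanging the two derivatives makes the basis direction the outer one, so the
      sum can be collected by linearity in that direction. A second exchange then restores the
      original order.\<close>
    by (subst expand[OF Z A vector_field_ddir_Sym[OF Y A V]])
      (simp add: sum.distrib ddir_ddir_commute[OF Z2 A \<sigma> V])
  also have "(\<Sum>b\<in>Basis. (Y A \<bullet> b) *\<^sub>R ddir (ddir Z V) (\<sigma> b) A) = ddir (ddir Z V) (Y A) A"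
    by (rule expand[OF vector_field_ddir[OF Z V] A YA, symmetric])
  also have "\<dots> = ddir (ddir Z (Y A)) V A" by (rule ddir_ddir_commute[OF Z2 A V YA])
  finally show ?thesis
    by (subst has_ddir_cong[OF _ A V]) (auto simp: add.commute expand[OF Z _ vector_field_Sym[OF Y]])
qed

subsection \<open>The Levi-Civita connection\<close>

text \<open>The difference quotient of \<open>t *\<^sub>R P t\<close> at 0 is \<open>P t\<close>, so
  a limit of \<open>P\<close> at 0 already gives differentiability of the product.\<close>

lemma has_vector_derivative_scaleR_at_0:
  assumes "(P \<longlongrightarrow> p) (at (0::real))"
  shows "((\<lambda>t. t *\<^sub>R P t) has_vector_derivative p) (at 0)"
  unfolding has_vector_derivative_def has_derivative_at
proof
  have "((\<lambda>t. norm (P t - p)) \<longlongrightarrow> norm (p - p)) (at 0)"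
    using assms by (intro tendsto_intros)
  then have "((\<lambda>t. norm (P t - p)) \<longlongrightarrow> 0) (at 0)" by simp
  then show "(\<lambda>t. norm ((0 + t) *\<^sub>R P (0 + t) - 0 *\<^sub>R P 0 - t *\<^sub>R p) / norm t) \<midarrow>0\<rightarrow> 0"
    by (rule Lim_transform_eventually)
      (auto simp: eventually_at_filter simp flip: scaleR_diff_right)
qed (rule bounded_linear_scaleR_left)

text \<open>The value comes from differentiating the Sylvester equation: the derivative solves the
  equation at \<open>A\<close> with right-hand side \<open>W' - (V ** w + w ** V)\<close>. Most of
  the proof establishes that the derivative exists.\<close>

lemma has_ddir_sylv:
  fixes W :: "real^'n^'n \<Rightarrow> real^'n^'n"
  assumes W: "has_ddir W W' V A" and A: "A \<in> SPD" and V: "V \<in> Sym"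
  defines "w \<equiv> sylv A (W A)"
  shows "has_ddir (\<lambda>B. sylv B (W B)) (sylv A (W' - (V ** w + w ** V))) V A"
proof -
  note L = bounded_linear_sylv[OF A]
  \<comment> \<open>\<open>G t = L (W\<^sub>t) - t P t\<close> with \<open>L\<close> the solution operator at \<open>A\<close>; so \<open>G\<close> stays bounded, hence is
     continuous at \<open>0\<close>, hence \<open>t P t\<close> has derivative \<open>lim P\<close>.\<close>
  define G where "G t = sylv (A + t *\<^sub>R V) (W (A + t *\<^sub>R V))" for t
  define P where "P t = sylv A (V ** G t + G t ** V)" for t
  have SPD: "\<forall>\<^sub>F t in nhds 0. A + t *\<^sub>R V \<in> SPD" by (rule SPD_line_eventually[OF A V])
  have G: "G t = sylv A (W (A + t *\<^sub>R V)) - t *\<^sub>R P t" if "A + t *\<^sub>R V \<in> SPD" for t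
  proof -
    have "A ** G t + G t ** A = W (A + t *\<^sub>R V) - t *\<^sub>R (V ** G t + G t ** V)"
      using sylv_eq[OF that, of "W (A + t *\<^sub>R V)"]
      by (simp add: G_def matrix_ring_simps algebra_simps)
    from sylv_unique[OF A this] show ?thesis
      by (simp add: P_def linear_simps[OF L])
  qed
  have LW: "((\<lambda>t. sylv A (W (A + t *\<^sub>R V))) has_vector_derivative sylv A W') (at 0)"
    by (rule bounded_linear.has_vector_derivative[OF L W])
  then have LW0: "((\<lambda>t. sylv A (W (A + t *\<^sub>R V))) \<longlongrightarrow> w) (at 0)"
    using has_vector_derivative_continuous[OF LW] by (simp add: isCont_def w_def)
  have "linear (\<lambda>H. sylv A (V ** H + H ** V))"
    using linear_compose[OF linear_sylvester bounded_linear.linear[OF L]] by (simp add: o_def)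
  then have Llin: "bounded_linear (\<lambda>H. sylv A (V ** H + H ** V))"
    by (simp add: linear_conv_bounded_linear)
  then obtain K where K: "0 < K" "\<And>H. norm (sylv A (V ** H + H ** V)) \<le> norm H * K"
    using bounded_linear.pos_bounded by blast
  \<comment> \<open>Below this threshold the correction \<open>t *\<^sub>R P t\<close> has norm at
    most half that of \<open>G t\<close> and can be absorbed, which bounds \<open>G t\<close> by
    twice the norm of the solution at \<open>A\<close>.\<close>
  have "\<forall>\<^sub>F t in nhds (0::real). \<bar>t\<bar> < 1 / (2 * K)"
    using K(1) by (auto simp: eventually_nhds_metric intro!: exI[of _ "1 / (2 * K)"])
  then have "\<forall>\<^sub>F t in nhds 0. norm (t *\<^sub>R P t) \<le> \<bar>t\<bar> * (2 * K * norm (sylv A (W (A + t *\<^sub>R V))))"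
    using SPD
  proof eventually_elim
    case (elim t)
    have "norm (t *\<^sub>R P t) \<le> \<bar>t\<bar> * (norm (G t) * K)"
      using K(2)[of "G t"] by (simp add: P_def mult_left_mono)
    moreover have "\<bar>t\<bar> * (norm (G t) * K) \<le> norm (G t) / 2"
      using elim(1) K(1) mult_right_mono[of "\<bar>t\<bar> * K" "1/2" "norm (G t)"] by (simp add: field_simps)
    moreover have "norm (G t) \<le> norm (sylv A (W (A + t *\<^sub>R V))) + norm (t *\<^sub>R P t)"
      by (subst G[OF elim(2)]) (rule norm_triangle_ineq4)
    ultimately have "norm (G t) \<le> 2 * norm (sylv A (W (A + t *\<^sub>R V)))" by linarith
    then have "\<bar>t\<bar> * (norm (G t) * K) \<le> \<bar>t\<bar> * (2 * norm (sylv A (W (A + t *\<^sub>R V))) * K)"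
      using K(1) by (intro mult_left_mono mult_right_mono) auto
    with \<open>norm (t *\<^sub>R P t) \<le> \<bar>t\<bar> * (norm (G t) * K)\<close> show ?case by (simp add: mult_ac)
  qed
  then have "\<forall>\<^sub>F t in at 0. norm (t *\<^sub>R P t) \<le> \<bar>t\<bar> * (2 * K * norm (sylv A (W (A + t *\<^sub>R V))))"
    unfolding eventually_at_filter by (rule eventually_mono) simp
  moreover have "((\<lambda>t. \<bar>t\<bar> * (2 * K * norm (sylv A (W (A + t *\<^sub>R V))))) \<longlongrightarrow> \<bar>0\<bar> * (2 * K * norm w)) (at 0)"
    by (intro tendsto_mult tendsto_rabs tendsto_norm tendsto_const tendsto_ident_at LW0)
  then have "((\<lambda>t. \<bar>t\<bar> * (2 * K * norm (sylv A (W (A + t *\<^sub>R V))))) \<longlongrightarrow> 0) (at 0)"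
    by simp
  ultimately have "((\<lambda>t. t *\<^sub>R P t) \<longlongrightarrow> 0) (at 0)"
    by (rule Lim_null_comparison)
  then have "((\<lambda>t. sylv A (W (A + t *\<^sub>R V)) - t *\<^sub>R P t) \<longlongrightarrow> w - 0) (at 0)"
    by (intro tendsto_diff LW0)
  then have "(G \<longlongrightarrow> w - 0) (at 0)"
    by (rule Lim_transform_eventually)
      (unfold eventually_at_filter, rule eventually_mono[OF SPD], simp add: G)
  then have "(P \<longlongrightarrow> sylv A (V ** w + w ** V)) (at 0)"
    unfolding P_def using bounded_linear.tendsto[OF Llin, of G w] by simp
  from has_vector_derivative_diff[OF LW has_vector_derivative_scaleR_at_0[OF this]]
  have "((\<lambda>t. sylv A (W (A + t *\<^sub>R V)) - t *\<^sub>R P t) has_vector_derivative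
      sylv A (W' - (V ** w + w ** V))) (at 0)"
    by (simp add: linear_simps[OF L])
  then have "(G has_vector_derivative sylv A (W' - (V ** w + w ** V))) (at 0)"
    by (subst has_vector_derivative_cong_ev[where g = "\<lambda>t. sylv A (W (A + t *\<^sub>R V)) - t *\<^sub>R P t"])
      (use A G[of 0] in \<open>auto intro!: eventually_mono[OF SPD] G\<close>)
  then show ?thesis by (simp add: G_def[abs_def])
qed

text \<open>Rotating every trace so that \<open>A\<close> comes first gives cyclic words with a
  single \<open>A\<close> a normal form, in which equal terms cancel by rewriting.\<close>

lemma trace_move_to_front:
  fixes A P Q R :: "real^'n^'n"
  shows "trace (P ** A) = trace (A ** P)"
    and "trace (P ** A ** Q) = trace (A ** Q ** P)"
    and "trace (P ** A ** Q ** R) = trace (A ** Q ** R ** P)"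
  using trace_mul_sym[of P A] trace_mul_sym[of P "A ** Q"] trace_mul_sym[of P "A ** Q ** R"]
  by (simp_all add: matrix_mul_assoc)

lemma anticommutator_Sym: "P \<in> Sym \<Longrightarrow> Q \<in> Sym \<Longrightarrow> P ** Q + Q ** P \<in> Sym"
  by (simp add: Sym_def transpose_simps add.commute)

text \<open>Three factors move with the base point. Each Sylvester factor contributes
  \<open>- trace (V ** (x ** y + y ** x)) / 2\<close>, the middle factor the same amount with
  opposite sign, so one copy survives.\<close>

lemma has_ddir_wasserstein:
  fixes X Y :: "real^'n^'n \<Rightarrow> real^'n^'n"
  assumes X: "has_ddir X X' V A" "X A \<in> Sym" "X' \<in> Sym"
    and Y: "has_ddir Y Y' V A" "Y A \<in> Sym" "Y' \<in> Sym"
    and A: "A \<in> SPD" and V: "V \<in> Sym"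
  defines "x \<equiv> sylv A (X A)" and "y \<equiv> sylv A (Y A)"
  shows "has_ddir (\<lambda>B. wasserstein B (X B) (Y B))
     (wasserstein A X' (Y A) + wasserstein A (X A) Y' - trace (V ** (x ** y + y ** x)) / 2) V A"
proof -
  define x' where "x' = sylv A (X' - (V ** x + x ** V))"
  define y' where "y' = sylv A (Y' - (V ** y + y ** V))"
  have xs: "x \<in> Sym" and ys: "y \<in> Sym"
    using X(2) Y(2) A by (simp_all add: x_def y_def sylv_Sym)
  note Vx = anticommutator_Sym[OF V xs] and Vy = anticommutator_Sym[OF V ys]
  have "has_ddir (\<lambda>B. sylv B (X B)) x' V A" "has_ddir (\<lambda>B. sylv B (Y B)) y' V A"
    unfolding x'_def y'_def x_def y_def
    by (rule has_ddir_sylv[OF X(1) A V], rule has_ddir_sylv[OF Y(1) A V])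
  from bounded_linear.has_vector_derivative[OF bounded_linear_trace
      mm.has_vector_derivative[OF mm.has_vector_derivative[OF this(2) has_ddir_ident] this(1)]]
  have "has_ddir (\<lambda>B. wasserstein B (X B) (Y B))
     (trace (y ** A ** x' + (y ** V + y' ** A) ** x)) V A"
    by (simp add: wasserstein_def x_def y_def)
  also have "trace (y ** A ** x' + (y ** V + y' ** A) ** x)
      = trace (y ** A ** x') + trace (y' ** A ** x) + trace (V ** x ** y)"
    by (simp add: matrix_ring_simps trace_simps trace_move_to_front(2)[of _ V])
  also have "trace (y ** A ** x') = wasserstein A X' (Y A) - trace ((V ** x + x ** V) ** y) / 2"
    using wasserstein_diff_left[OF A, of X' "V ** x + x ** V" "Y A"]
      wasserstein_eq_trace[OF A Vx Y(2)]
    by (simp add: wasserstein_def x'_def y_def)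
  also have "trace (y' ** A ** x) = wasserstein A (X A) Y' - trace ((V ** y + y ** V) ** x) / 2"
  proof -
    have "trace (y' ** A ** x) = wasserstein A (X A) (Y' - (V ** y + y ** V))"
      by (simp add: wasserstein_def y'_def x_def)
    also have "\<dots> = wasserstein A (Y' - (V ** y + y ** V)) (X A)"
      by (rule wasserstein_commute[OF A X(2) Sym_diff[OF Y(3) Vy]])
    also have "\<dots> = wasserstein A (X A) Y' - trace ((V ** y + y ** V) ** x) / 2"
      unfolding wasserstein_diff_left[OF A] wasserstein_eq_trace[OF A Vy X(2)]
      by (simp add: wasserstein_commute[OF A Y(3) X(2)] x_def)
    finally show ?thesis .
  qed
  \<comment> \<open>The two orders agree by transposition, as \<open>V\<close>, \<open>x\<close> and
    \<open>y\<close> are symmetric; this puts the middle contribution into the shape of the other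
    two.\<close>
  also have "trace (V ** x ** y) = (trace (V ** x ** y) + trace (V ** y ** x)) / 2"
  proof -
    have "trace (V ** x ** y) = trace (transpose (V ** x ** y))" by simp
    also have "\<dots> = trace (V ** y ** x)"
      using xs ys V trace_mul_sym[of "y ** x" V] by (simp add: matrix_transpose_mul Sym_def matrix_mul_assoc)
    finally show ?thesis by simp
  qed
  finally show ?thesis
    by (rule arg_cong[where f = "\<lambda>d. has_ddir _ d V A", THEN iffD1, rotated])
      (simp add: matrix_ring_simps trace_simps trace_move_to_front(2)[of _ V] field_simps)
qed

text \<open>Pairing the Koszul formula with a constant field leaves these three derivatives of the metric.\<close>

lemma christoffel_trace_identity:
  fixes A a b c :: "real^'n^'n"
  shows "trace ((A ** c + c ** A) ** (a ** b + b ** a))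
      - trace ((A ** a + a ** A) ** (b ** c + c ** b))
      - trace ((A ** b + b ** A) ** (a ** c + c ** a))
    = - 2 * trace ((a ** A ** b + b ** A ** a) ** c)"
  by (simp add: matrix_ring_simps trace_simps trace_move_to_front[of _ A])

text \<open>Metric compatibility and vanishing torsion determine the pairing of
  \<open>D X Y A\<close> with every tangent vector, and the metric is definite.\<close>

lemma levi_civita_wasserstein_eq:
  fixes D :: "'n::finite conn" and X Y :: "real^'n^'n \<Rightarrow> real^'n^'n"
  assumes D: "levi_civita wasserstein D"
    and X: "vector_field X" and Y: "vector_field Y" and A: "A \<in> SPD"
  defines "a \<equiv> sylv A (X A)" and "b \<equiv> sylv A (Y A)"
  shows "D X Y A = ddir Y (X A) A - (a ** A ** b + b ** A ** a)"
proof -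
  note XA = vector_field_Sym[OF X A] and YA = vector_field_Sym[OF Y A]
  have DS: "D U W A \<in> Sym" if "vector_field U" "vector_field W" for U W
  proof -
    have "vector_field (D U W)"
      using D that by (simp add: levi_civita_def affine_connection_def)
    then show ?thesis by (rule vector_field_Sym[OF _ A])
  qed
  have torsion: "D U W A - D W U A = ddir W (U A) A - ddir U (W A) A"
    if "vector_field U" "vector_field W" for U W
    using D that A by (simp add: levi_civita_def torsion_free_def lie_bracket_def)
  have metric: "wasserstein A (D U V A) (W A) + wasserstein A (V A) (D U W A)
      = wasserstein A (ddir V (U A) A) (W A) + wasserstein A (V A) (ddir W (U A) A)
        - trace (U A ** (sylv A (V A) ** sylv A (W A) + sylv A (W A) ** sylv A (V A))) / 2"
    if U: "vector_field U" and V: "vector_field V" and W: "vector_field W" for U V W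
  proof -
    note S = vector_field_Sym[OF _ A] vector_field_ddir_Sym[OF _ A] vector_field_has_ddir[OF _ A]
    have "ddir (\<lambda>B. wasserstein B (V B) (W B)) (U A) A
      = wasserstein A (D U V A) (W A) + wasserstein A (V A) (D U W A)"
      using D U V W A by (simp add: levi_civita_def metric_compatible_def)
    moreover have "ddir (\<lambda>B. wasserstein B (V B) (W B)) (U A) A
      = wasserstein A (ddir V (U A) A) (W A) + wasserstein A (V A) (ddir W (U A) A)
        - trace (U A ** (sylv A (V A) ** sylv A (W A) + sylv A (W A) ** sylv A (V A))) / 2"
      by (intro ddir_eq has_ddir_wasserstein S U V W A)
    ultimately show ?thesis by simp
  qed
  have M: "a ** A ** b + b ** A ** a \<in> Sym"
    using sylv_Sym[OF A XA] sylv_Sym[OF A YA] SPD_sym[OF A]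
    by (simp add: a_def b_def Sym_def transpose_simps matrix_mul_assoc add.commute)
  \<comment> \<open>The discrepancy from the claimed formula. Orthogonality to all of
    \<open>Sym\<close> includes orthogonality to \<open>E\<close> itself, which forces
    \<open>E\<close> to vanish.\<close>
  define E where "E = D X Y A - (ddir Y (X A) A - (a ** A ** b + b ** A ** a))"
  have E: "E \<in> Sym"
    unfolding E_def by (intro Sym_diff DS X Y vector_field_ddir_Sym A XA M)
  have "wasserstein A E Z = 0" if Z: "Z \<in> Sym" for Z
  proof -
    define c where "c = sylv A Z"
    let ?Z = "\<lambda>_. Z"
    note Zf = vector_field_const[OF Z]
    have dZ: "ddir ?Z V A = 0" for V :: "real^'n^'n" by (intro ddir_eq) simp
    have g0: "wasserstein A V 0 = 0" for V by (simp add: wasserstein_def linear_simps[OF bounded_linear_sylv[OF A]] trace_simps)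
    let ?g = "wasserstein A"
    have e1: "?g (D X Y A) Z + ?g (Y A) (D X ?Z A)
        = ?g (ddir Y (X A) A) Z - trace (X A ** (b ** c + c ** b)) / 2"
      using metric[OF X Y Zf] by (simp add: dZ g0 b_def c_def)
    have e2: "?g (D Y X A) Z + ?g (X A) (D Y ?Z A)
        = ?g (ddir X (Y A) A) Z - trace (Y A ** (a ** c + c ** a)) / 2"
      using metric[OF Y X Zf] by (simp add: dZ g0 a_def c_def)
    have e3: "?g (D ?Z X A) (Y A) + ?g (X A) (D ?Z Y A)
        = ?g (ddir X Z A) (Y A) + ?g (X A) (ddir Y Z A) - trace (Z ** (a ** b + b ** a)) / 2"
      using metric[OF Zf X Y] by (simp add: a_def b_def)
    have t1: "?g (D X Y A) Z - ?g (D Y X A) Z = ?g (ddir Y (X A) A) Z - ?g (ddir X (Y A) A) Z"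
      using torsion[OF X Y] by (simp flip: wasserstein_diff_left[OF A])
    have t2: "?g (D X ?Z A) (Y A) - ?g (D ?Z X A) (Y A) = - ?g (ddir X Z A) (Y A)"
      using torsion[OF X Zf] by (simp add: dZ flip: wasserstein_diff_left[OF A] wasserstein_minus_left[OF A])
    have t3: "?g (D Y ?Z A) (X A) - ?g (D ?Z Y A) (X A) = - ?g (ddir Y Z A) (X A)"
      using torsion[OF Y Zf] by (simp add: dZ flip: wasserstein_diff_left[OF A] wasserstein_minus_left[OF A])
    have comm: "?g (Y A) (D X ?Z A) = ?g (D X ?Z A) (Y A)" "?g (X A) (D Y ?Z A) = ?g (D Y ?Z A) (X A)"
      "?g (X A) (D ?Z Y A) = ?g (D ?Z Y A) (X A)" "?g (X A) (ddir Y Z A) = ?g (ddir Y Z A) (X A)"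
      by (intro wasserstein_commute A XA YA DS X Y Zf vector_field_ddir_Sym Z)+
    \<comment> \<open>The combination \<open>e1 + e2 - e3\<close>, with \<open>t1\<close>,
      \<open>t2\<close>, \<open>t3\<close> removing the remaining connection terms, leaves exactly
      these three traces.\<close>
    have "trace (Z ** (a ** b + b ** a)) - trace (X A ** (b ** c + c ** b)) - trace (Y A ** (a ** c + c ** a))
        = - 2 * trace ((a ** A ** b + b ** A ** a) ** c)"
      using christoffel_trace_identity[of A c a b]
      by (simp only: a_def b_def c_def sylv_eq[OF A])
    moreover have "trace ((a ** A ** b + b ** A ** a) ** c) = 2 * ?g (a ** A ** b + b ** A ** a) Z"
      using wasserstein_eq_trace[OF A M Z] by (simp add: c_def)
    moreover have "?g E Z = ?g (D X Y A) Z - (?g (ddir Y (X A) A) Z - ?g (a ** A ** b + b ** A ** a) Z)"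
      by (simp add: E_def wasserstein_diff_left[OF A])
    ultimately show ?thesis
      using e1 e2 e3 t1 t2 t3 comm by linarith
  qed
  from wasserstein_definite[OF A E this[OF E]] show ?thesis by (simp add: E_def)
qed

subsection \<open>Curvature\<close>

lemma trace_move_to_front_long:
  fixes A P Q R S T :: "real^'n^'n"
  shows "trace (P ** A ** Q ** R ** S) = trace (A ** Q ** R ** S ** P)"
    and "trace (P ** A ** Q ** R ** S ** T) = trace (A ** Q ** R ** S ** T ** P)"
  using trace_mul_sym[of P "A ** Q ** R ** S"] trace_mul_sym[of P "A ** Q ** R ** S ** T"]
  by (simp_all add: matrix_mul_assoc)

text \<open>Multiplying the equation by \<open>r\<close> shows that
  \<open>trace (A ** k ** r) - trace (A ** r ** k)\<close> equals
  \<open>2 * trace (A ** r ** r)\<close>; these are the cross terms of the product on the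
  right.\<close>

lemma sylvester_commutator_trace:
  fixes A r k :: "real^'n^'n"
  assumes r: "A ** r + r ** A = A ** k - k ** A"
  shows "trace (A ** k ** k) + trace (A ** r ** r) = - trace ((r + k) ** A ** (r - k))"
proof -
  have "trace ((A ** r + r ** A) ** r) = trace ((A ** k - k ** A) ** r)"
    "trace ((A ** r + r ** A) ** k) = trace ((A ** k - k ** A) ** k)"
    by (simp_all only: r)
  then show ?thesis
    by (simp add: matrix_ring_simps trace_simps trace_move_to_front[of _ A])
qed

text \<open>\<open>M\<close> is bilinear and symmetric, so all terms in \<open>m\<close> and
  \<open>n\<close> cancel and their defining equations never enter. The rest is cyclicity of the
  trace together with the equation for \<open>r\<close>.\<close>

lemma curvature_trace_identity:
  fixes A a b k r m n :: "real^'n^'n"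
  assumes k: "k = (1/2) *\<^sub>R (a ** b - b ** a)" and r: "A ** r + r ** A = A ** k - k ** A"
  defines "s \<equiv> (1/2) *\<^sub>R (a ** b + b ** a)" and "x \<equiv> A ** a + a ** A" and "y \<equiv> A ** b + b ** A"
  defines "M \<equiv> \<lambda>u v. u ** A ** v + v ** A ** u"
  shows "trace ((b ** x ** a + a ** x ** b - 2 *\<^sub>R (a ** y ** a) - M (s + m + r) a + 2 *\<^sub>R M a (s + m - r)
      - M b (a ** a + n) - M a m + M b n) ** b) = 6 * trace ((r + k) ** A ** (r - k))"
proof -
  \<comment> \<open>Expanding with \<open>a ** b = s + k\<close> and \<open>b ** a = s - k\<close>
    leaves mixed traces of \<open>r\<close> or \<open>k\<close> with each other and with
    \<open>s\<close>; these two pairings of the equation eliminate them.\<close>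
  have "trace ((A ** r + r ** A) ** r) = trace ((A ** k - k ** A) ** r)"
    "trace ((A ** r + r ** A) ** s) = trace ((A ** k - k ** A) ** s)"
    by (simp_all only: r)
  then have "trace ((b ** x ** a + a ** x ** b - 2 *\<^sub>R (a ** y ** a) - M (s + m + r) a + 2 *\<^sub>R M a (s + m - r)
      - M b (a ** a + n) - M a m + M b n) ** b) = - 6 * (trace (A ** k ** k) + trace (A ** r ** r))"
    unfolding M_def s_def x_def y_def k
    by (simp only: matrix_ring_simps trace_simps trace_move_to_front[of _ A] trace_move_to_front_long[of _ A]
        real_scaleR_def) (simp add: field_simps)
  also have "\<dots> = 6 * trace ((r + k) ** A ** (r - k))"
    unfolding sylvester_commutator_trace[OF r] by simp
  finally show ?thesis .
qed

section \<open>From the connection formula to the curvature\<close>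

lemma levi_civita_field:
  "levi_civita g D \<Longrightarrow> vector_field X \<Longrightarrow> vector_field Y \<Longrightarrow> vector_field (D X Y)"
  by (simp add: levi_civita_def affine_connection_def)

text \<open>Smoothness is read off from torsion-freeness: on \<open>SPD\<close> the bracket is a
  difference of two fields produced by \<open>D\<close>. This bypasses differentiating repeatedly in
  varying directions.\<close>

lemma levi_civita_bracket:
  fixes D :: "'n::finite conn" and X Y :: "real^'n^'n \<Rightarrow> real^'n^'n"
  assumes D: "levi_civita g D" and X: "vector_field X" and Y: "vector_field Y"
  shows "vector_field (lie_bracket X Y)"
proof -
  have eq: "D X Y B - D Y X B = lie_bracket X Y B" if "B \<in> SPD" for B
    using D X Y that by (simp add: levi_civita_def torsion_free_def)
  note f = levi_civita_field[OF D X Y] levi_civita_field[OF D Y X]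
  have "Ck k (\<lambda>B. D X Y B - D Y X B)" for k
    using f by (simp add: vector_field_def Ck_diff)
  moreover have "Ck k (\<lambda>B. D X Y B - D Y X B) \<longleftrightarrow> Ck k (lie_bracket X Y)" for k
    using eq by (rule Ck_cong)
  ultimately have "Ck k (lie_bracket X Y)" for k by blast
  moreover have "lie_bracket X Y B \<in> Sym" if "B \<in> SPD" for B
    using Sym_diff[OF vector_field_Sym[OF f(1) that] vector_field_Sym[OF f(2) that]] eq[OF that] by simp
  ultimately show ?thesis by (simp add: vector_field_def)
qed

text \<open>The explicit formula for \<open>D Y Z\<close> is differentiated along \<open>x\<close>,
  with the product rule applied to \<open>M b c\<close> and its base point, and then fed back into
  the formula for \<open>D X\<close>.\<close>

lemma levi_civita_wasserstein_iterated:
  fixes D :: "'n::finite conn" and X Y Z :: "real^'n^'n \<Rightarrow> real^'n^'n"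
  assumes D: "levi_civita wasserstein D"
    and X: "vector_field X" and Y: "vector_field Y" and Z: "vector_field Z" and A: "A \<in> SPD"
  defines "x \<equiv> X A" and "a \<equiv> sylv A (X A)" and "b \<equiv> sylv A (Y A)" and "c \<equiv> sylv A (Z A)"
    and "M \<equiv> \<lambda>u v. u ** A ** v + v ** A ** u"
  shows "D X (D Y Z) A = ddir Z (ddir Y x A) A + ddir (ddir Z (Y A)) x A
     - M (sylv A (ddir Y x A - (x ** b + b ** x))) c - (b ** x ** c + c ** x ** b)
     - M b (sylv A (ddir Z x A - (x ** c + c ** x)))
     - M a (sylv A (ddir Z (Y A) A - M b c))"
proof -
  note xS = vector_field_Sym[OF X A]
  define y' where "y' = sylv A (ddir Y x A - (x ** b + b ** x))"
  define z' where "z' = sylv A (ddir Z x A - (x ** c + c ** x))"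
  have dy: "has_ddir (\<lambda>B. sylv B (Y B)) y' x A"
    unfolding y'_def b_def x_def by (rule has_ddir_sylv[OF vector_field_has_ddir[OF Y A xS] A xS])
  have dz: "has_ddir (\<lambda>B. sylv B (Z B)) z' x A"
    unfolding z'_def c_def x_def by (rule has_ddir_sylv[OF vector_field_has_ddir[OF Z A xS] A xS])
  note md = mm.has_vector_derivative[OF mm.has_vector_derivative[OF _ has_ddir_ident]]
  have "has_ddir (\<lambda>B. ddir Z (Y B) B
        - (sylv B (Y B) ** B ** sylv B (Z B) + sylv B (Z B) ** B ** sylv B (Y B)))
      (ddir Z (ddir Y x A) A + ddir (ddir Z (Y A)) x A
        - ((b ** A ** z' + (b ** x + y' ** A) ** c) + (c ** A ** y' + (c ** x + z' ** A) ** b))) x A"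
    using has_vector_derivative_diff[OF has_ddir_ddir_along_field[OF Y Z A xS, folded x_def]
        has_vector_derivative_add[OF md[OF dy dz] md[OF dz dy]]]
    by (simp add: b_def c_def)
  then have "has_ddir (D Y Z) (ddir Z (ddir Y x A) A + ddir (ddir Z (Y A)) x A
        - ((b ** A ** z' + (b ** x + y' ** A) ** c) + (c ** A ** y' + (c ** x + z' ** A) ** b))) x A"
    using has_ddir_cong[of "D Y Z", OF levi_civita_wasserstein_eq[OF D Y Z] A, of x] xS
    by (simp add: x_def)
  from ddir_eq[OF this]
  show ?thesis
    unfolding levi_civita_wasserstein_eq[OF D X levi_civita_field[OF D Y Z] A]
      levi_civita_wasserstein_eq[OF D Y Z A]
    by (simp add: M_def x_def a_def b_def c_def y'_def z'_def matrix_ring_simps algebra_simps)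
qed

text \<open>Second derivatives of \<open>X\<close> cancel by their symmetry, and first derivatives
  of both fields cancel by linearity of \<open>sylv A\<close> and bilinearity of \<open>M\<close>.
  Only the values at \<open>A\<close> survive, so tensoriality is visible here.\<close>

lemma curvature_wasserstein:
  fixes D :: "'n::finite conn" and X Y :: "real^'n^'n \<Rightarrow> real^'n^'n"
  assumes D: "levi_civita wasserstein D"
    and X: "vector_field X" and Y: "vector_field Y" and A: "A \<in> SPD"
    and M: "\<And>u v. M u v = u ** A ** v + v ** A ** u"
  defines "x \<equiv> X A" and "y \<equiv> Y A" and "a \<equiv> sylv A (X A)" and "b \<equiv> sylv A (Y A)"
  shows "curvature D X Y X A
    = b ** x ** a + a ** x ** b - 2 *\<^sub>R (a ** y ** a)
      - M (sylv A (x ** b + b ** x)) a + 2 *\<^sub>R M a (sylv A (y ** a + a ** y))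
      - M b (sylv A (x ** a + a ** x)) - M a (sylv A (M b a)) + M b (sylv A (M a a))"
proof -
  note xS = vector_field_Sym[OF X A, folded x_def] and yS = vector_field_Sym[OF Y A, folded y_def]
  note L = linear_simps[OF bounded_linear_sylv[OF A]]
  have X2: "Ck 2 X" using X by (simp add: vector_field_def)
  have br: "lie_bracket X Y A = ddir Y x A - ddir X y A"
    by (simp add: lie_bracket_def x_def y_def)
  have bracket: "D (lie_bracket X Y) X A = ddir X (ddir Y x A) A - ddir X (ddir X y A) A
      - M (sylv A (ddir Y x A - ddir X y A)) a"
    unfolding levi_civita_wasserstein_eq[OF D levi_civita_bracket[OF D X Y] X A] br
    by (simp add: ddir_along_diff[OF X A] vector_field_ddir_Sym X Y A xS yS M a_def)
  have comm: "ddir (ddir X y) x A = ddir (ddir X x) y A"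
    by (rule ddir_ddir_commute[OF X2 A yS xS])
  show ?thesis
    unfolding curvature_def levi_civita_wasserstein_iterated[OF D X Y X A]
      levi_civita_wasserstein_iterated[OF D Y X X A] bracket
    by (simp add: x_def[symmetric] y_def[symmetric] a_def[folded x_def, symmetric] b_def[folded y_def, symmetric]
        comm M L matrix_ring_simps scaleR_2 algebra_simps)
qed

theorem corollary6p2:
  fixes D :: "'n::finite conn" and A X Y :: "real^'n^'n"
  assumes "levi_civita wasserstein D"
    and "A \<in> SPD" and "X \<in> Sym" and "Y \<in> Sym"
  shows "riemann wasserstein D A X Y X Y \<ge> 0"
proof -
  note D = assms(1) and A = assms(2)
  \<comment> \<open>Constant fields show that the choice in \<open>extension\<close> succeeds; which
    extension is chosen is immaterial, since the curvature formula depends only on values at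
    \<open>A\<close>.\<close>
  have ext: "vector_field (extension A Z) \<and> extension A Z A = Z" if "Z \<in> Sym" for Z
    unfolding extension_def by (rule someI[of _ "\<lambda>_. Z"]) (simp add: vector_field_const that)
  define F where "F = extension A X"
  define G where "G = extension A Y"
  have F: "vector_field F" "F A = X" and G: "vector_field G" "G A = Y"
    using ext assms by (auto simp: F_def G_def)
  define a where "a = sylv A X"
  define b where "b = sylv A Y"
  define s where "s = (1/2) *\<^sub>R (a ** b + b ** a)"
  define k where "k = (1/2) *\<^sub>R (a ** b - b ** a)"
  define r where "r = sylv A (A ** k - k ** A)"
  define M where "M = (\<lambda>u v. u ** A ** v + v ** A ** u)"
  define m where "m = sylv A (M a b)"
  define n where "n = sylv A (M a a)"
  have ab: "a ** b = s + k" and ba: "b ** a = s - k"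
    by (simp_all add: s_def k_def flip: scaleR_add_right scaleR_diff_right)
  have at: "transpose a = a" and bt: "transpose b = b"
    using sylv_Sym[OF A assms(3)] sylv_Sym[OF A assms(4)] by (simp_all add: a_def b_def Sym_def)
  \<comment> \<open>A commutator of symmetric matrices is skew, so \<open>A ** k - k ** A\<close> is
    symmetric and hence so is \<open>r\<close>.\<close>
  have kt: "transpose k = - k"
    by (simp add: k_def transpose_simps at bt flip: scaleR_minus_right)
  have rt: "transpose r = r"
    by (simp add: r_def transpose_sylv[OF A] transpose_simps kt SPD_sym[OF A] matrix_ring_simps)
  have r: "A ** r + r ** A = A ** k - k ** A" unfolding r_def by (rule sylv_eq[OF A])
  have m: "A ** m + m ** A = M a b" unfolding m_def by (rule sylv_eq[OF A])
  have n: "A ** n + n ** A = M a a" unfolding n_def by (rule sylv_eq[OF A])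
  have x: "X = A ** a + a ** A" and y: "Y = A ** b + b ** A"
    by (simp_all add: a_def b_def sylv_eq[OF A])
  \<comment> \<open>Expanding \<open>X\<close> gives
    \<open>A ** (s + k) + (s - k) ** A + M a b\<close>. The \<open>s\<close> part is already in
    Sylvester form, the \<open>k\<close> part is solved by \<open>r\<close>, and the rest by
    \<open>m\<close>. Exchanging \<open>a\<close> and \<open>b\<close> reverses the sign of
    \<open>k\<close>, hence of \<open>r\<close>, in \<open>p'\<close>.\<close>
  have p: "sylv A (X ** b + b ** X) = s + m + r"
  proof (rule sylv_unique[OF A])
    have "A ** (s + m + r) + (s + m + r) ** A
        = (A ** s + s ** A) + (A ** m + m ** A) + (A ** r + r ** A)"
      by (simp add: matrix_ring_simps algebra_simps)
    also have "\<dots> = A ** (s + k) + (s - k) ** A + M a b"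
      unfolding m r by (simp add: matrix_ring_simps algebra_simps)
    also have "\<dots> = X ** b + b ** X"
      by (simp add: x M_def matrix_ring_simps flip: ab ba)
    finally show "A ** (s + m + r) + (s + m + r) ** A = X ** b + b ** X" .
  qed
  have p': "sylv A (Y ** a + a ** Y) = s + m - r"
  proof (rule sylv_unique[OF A])
    have "A ** (s + m - r) + (s + m - r) ** A
        = (A ** s + s ** A) + (A ** m + m ** A) - (A ** r + r ** A)"
      by (simp add: matrix_ring_simps algebra_simps)
    also have "\<dots> = A ** (s - k) + (s + k) ** A + M a b"
      unfolding m r by (simp add: matrix_ring_simps algebra_simps)
    also have "\<dots> = Y ** a + a ** Y"
      by (simp add: y M_def matrix_ring_simps flip: ab ba)
    finally show "A ** (s + m - r) + (s + m - r) ** A = Y ** a + a ** Y" .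
  qed
  have q: "sylv A (X ** a + a ** X) = a ** a + n"
  proof (rule sylv_unique[OF A])
    have "A ** (a ** a + n) + (a ** a + n) ** A = A ** a ** a + a ** a ** A + (A ** n + n ** A)"
      by (simp add: matrix_ring_simps algebra_simps)
    also have "\<dots> = X ** a + a ** X"
      unfolding n by (simp add: x M_def matrix_ring_simps algebra_simps)
    finally show "A ** (a ** a + n) + (a ** a + n) ** A = X ** a + a ** X" .
  qed
  have Mcomm: "M b a = M a b" by (simp add: M_def add.commute)
  have curv: "curvature D F G F A
    = b ** X ** a + a ** X ** b - 2 *\<^sub>R (a ** Y ** a) - M (s + m + r) a + 2 *\<^sub>R M a (s + m - r)
      - M b (a ** a + n) - M a m + M b n"
    using curvature_wasserstein[OF D F(1) G(1) A, of M]
    unfolding F(2) G(2) a_def[symmetric] b_def[symmetric] p p' q Mcomm m_def[symmetric] n_def[symmetric]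
    by (simp add: M_def)
  \<comment> \<open>The trace form of the metric is available only for symmetric arguments.\<close>
  have "curvature D F G F A \<in> Sym"
    unfolding curvature_def
    by (intro Sym_add Sym_diff vector_field_Sym[OF _ A] levi_civita_field[OF D]
        levi_civita_bracket[OF D] F(1) G(1))
  from wasserstein_eq_trace[OF A this assms(4)]
  have "riemann wasserstein D A X Y X Y = trace (curvature D F G F A ** b) / 2"
    by (simp add: riemann_def F_def G_def b_def)
  also have "\<dots> = 3 * trace ((r + k) ** A ** (r - k))"
    using curvature_trace_identity[OF k_def r, of m n] by (simp add: curv x y s_def M_def)
  also have "\<dots> = 3 * trace (transpose (r - k) ** A ** (r - k))"
    by (simp add: transpose_simps rt kt)
  also have "\<dots> \<ge> 0" using trace_congruence_nonneg[OF A] by simp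
  finally show ?thesis .
qed

end
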